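(* Let $b\ge 2$, $n\ge 2$, and let $P$ be the $n\times n$ matrix $P(i,j)=\mathbb{P}\{jb\le i+X_1+\cdots+X_n\le (j+1)b-1\}$, $0\le i,j\le n-1$, with $X_1,\dots,X_n$ independent uniform on $\{0,\dots,b-1\}$. Let $\pi(j)=A(n,j)/n!$, where $A(n,j)$ is the number of permutations in $S_n$ with exactly $j$ descents, and define the separation distance $\mathrm{sep}(r)=\max_{0\le j\le n-1}\left[1-\frac{P^r(0,j)}{\pi(j)}\right]$. Then: (1) for all $r\ge 0$, the maximum defining $\mathrm{sep}(r)$ is attained at $j=n-1$; (2) for $r=2\log_b(n)+\log_b(c)$ with $c>0$ fixed, $\mathrm{sep}(r)\to 1-e^{-1/(2c)}$ as $n\to\infty$.
   Context: $P$ is the transition matrix of the carries chain when $n$ random base-$b$ numbers are added (started at carry $0$), and $\pi$ is its stationary distribution. A permutation $\sigma$ has a descent at $i$ if $\sigma(i+1)<\sigma(i)$. *)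

theory Defs
  imports
    "HOL-Probability.Product_PMF"
    "HOL-Combinatorics.Permutations"
    "Jordan_Normal_Form.Matrix"
begin

definition carries_prob :: "nat \<Rightarrow> nat \<Rightarrow> nat \<Rightarrow> nat \<Rightarrow> real" where
  "carries_prob b n i j =
     measure_pmf.prob (Pi_pmf {1..n} 0 (\<lambda>_. pmf_of_set {0..b - 1}))
       {X. j * b \<le> i + (\<Sum>k=1..n. X k) \<and> i + (\<Sum>k=1..n. X k) \<le> (j + 1) * b - 1}"

definition carries_mat :: "nat \<Rightarrow> nat \<Rightarrow> real mat" where
  "carries_mat b n = mat n n (\<lambda>(i, j). carries_prob b n i j)"

definition descents :: "nat \<Rightarrow> (nat \<Rightarrow> nat) \<Rightarrow> nat set" where
  "descents n \<sigma> = {i \<in> {1..n - 1}. \<sigma> (i + 1) < \<sigma> i}"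

definition num_perms_descents :: "nat \<Rightarrow> nat \<Rightarrow> nat" where
  "num_perms_descents n j = card {\<sigma>. \<sigma> permutes {1..n} \<and> card (descents n \<sigma>) = j}"

definition carries_stat :: "nat \<Rightarrow> nat \<Rightarrow> real" where
  "carries_stat n j = real (num_perms_descents n j) / fact n"

definition sep_term :: "nat \<Rightarrow> nat \<Rightarrow> nat \<Rightarrow> nat \<Rightarrow> real" where
  "sep_term b n r j = 1 - (carries_mat b n ^\<^sub>m r) $$ (0, j) / carries_stat n j"

definition sep :: "nat \<Rightarrow> nat \<Rightarrow> nat \<Rightarrow> real" where
  "sep b n r = Max (sep_term b n r ` {0..n - 1})"

text \<open>
  The number of steps \<open>r\<close> is an integer, so for fixed \<open>b\<close> and \<open>c\<close> the equation
  \<open>r = 2 log\<^sub>b n + log\<^sub>b c\<close> is solvable only for special \<open>n\<close>, and for most \<open>c\<close> for none;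
  with \<open>r\<close> rounded to an integer the limit does not exist.  The asymptotic claim is
  therefore stated along arbitrary sequences \<open>n\<^sub>k \<rightarrow> \<infinity>\<close> with
  \<open>r\<^sub>k = 2 log\<^sub>b n\<^sub>k + log\<^sub>b c\<^sub>k\<close> and \<open>c\<^sub>k \<rightarrow> c\<close>.  The constant sequence \<open>c\<^sub>k = c\<close> is the
  literal equation, and for every \<open>c > 0\<close> such sequences exist, for example
  \<open>r\<^sub>k = k\<close> with \<open>n\<^sub>k\<close> the integer part of the square root of \<open>b\<^sup>k / c\<close>.
\<close>

end

theory Submission imports
  Defs
  "HOL-Library.Infinite_Set"
  "HOL-Number_Theory.Cong"
begin

text \<open>
  Splitting base-\<open>ab\<close> digits into a base-\<open>a\<close> and a base-\<open>b\<close> part shows that \<open>r\<close> steps of the base-\<open>b\<close>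
  chain from carry \<open>0\<close> amount to one step of the base-\<open>a\<close> chain, \<open>a = b\<^sup>r\<close>.  Replacing a word
  in \<open>{0..<a}\<^sup>n\<close> by its partial sums modulo \<open>a\<close> is a bijection that turns the carry into the number of
  descents, so \<open>a\<^sup>n P\<^sup>r(0,j)\<close> counts the words with \<open>j\<close> descents.  The words with distinct
  letters among these number \<open>(a choose n) A(n,j)\<close>, and for \<open>j = n - 1\<close> there are no others.
  Hence \<open>P\<^sup>r(0,j) / \<pi>(j)\<close> is smallest at \<open>j = n - 1\<close>, where it is the birthday
  probability \<open>\<Prod>i<n. 1 - i/a\<close>.
\<close>

section \<open>Words and carry counts\<close>

text \<open>Letters outside \<open>{1..n}\<close> are pinned to the default 0 that
  \<open>Pi_pmf\<close> also uses, so a word is determined by its \<open>n\<close> letters and the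
  digits are sampled uniformly from this set.\<close>

definition words :: "nat \<Rightarrow> nat \<Rightarrow> (nat \<Rightarrow> nat) set" where
  "words a n = PiE_dflt {1..n} 0 (\<lambda>_. {..<a})"

text \<open>Unnormalised transition counts; as natural numbers they let the composition of two steps
  be proved by a bijection.\<close>

definition carry_count :: "nat \<Rightarrow> nat \<Rightarrow> nat \<Rightarrow> nat \<Rightarrow> nat" where
  "carry_count a n i j = card {x \<in> words a n. (i + (\<Sum>k=1..n. x k)) div a = j}"

lemma mem_words_iff: "x \<in> words a n \<longleftrightarrow> (\<forall>i\<in>{1..n}. x i < a) \<and> (\<forall>i. i \<notin> {1..n} \<longrightarrow> x i = 0)"
  unfolding words_def PiE_dflt_def by auto

lemma finite_words [simp]: "finite (words a n)"
  unfolding words_def by (rule finite_PiE_dflt) auto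

lemma card_words: "card (words a n) = a ^ n"
  unfolding words_def by (subst card_PiE_dflt) auto

lemma carries_prob_eq:
  assumes "b \<ge> 2"
  shows "carries_prob b n i j = real (carry_count b n i j) / real b ^ n"
proof -
  have "{0..b - 1} = {..<b}" using assms by auto
  then have "Pi_pmf {1..n} 0 (\<lambda>_. pmf_of_set {0..b - 1}) = pmf_of_set (words b n)"
    unfolding words_def using assms by (subst Pi_pmf_of_set) (auto simp: lessThan_empty_iff)
  moreover have "words b n \<noteq> {}"
    using card_words[of b n] assms by (metis card.empty not_numeral_le_zero power_not_zero)
  \<comment> \<open>The subtraction is truncated, but \<open>(j + 1) * b\<close> is positive, so the
    interval is exactly a fibre of \<open>div b\<close>.\<close>
  moreover have "j * b \<le> s \<and> s \<le> (j + 1) * b - 1 \<longleftrightarrow> s div b = j" for s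
  proof -
    have "s \<le> (j + 1) * b - 1 \<longleftrightarrow> s < (j + 1) * b"
      using assms by (simp add: algebra_simps) linarith
    then show ?thesis
      using assms by (auto simp: div_nat_eqI dividend_less_times_div algebra_simps)
  qed
  ultimately have "carries_prob b n i j
      = real (card (words b n \<inter> {x. (i + (\<Sum>k=1..n. x k)) div b = j})) / real (card (words b n))"
    unfolding carries_prob_def by (simp add: measure_pmf_of_set)
  then show ?thesis
    by (simp only: carry_count_def card_words Int_def mem_Collect_eq of_nat_power)
qed

section \<open>Composing steps by multiplying bases\<close>

lemma bij_betw_words_mult:
  assumes "a > 0"
  shows "bij_betw (\<lambda>x. (\<lambda>i. x i mod a, \<lambda>i. x i div a)) (words (a * b) n) (words a n \<times> words b n)"
proof (rule bij_betw_byWitness[where f' = "\<lambda>(y, z). \<lambda>i. y i + a * z i"])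
  show "(\<lambda>(y, z). \<lambda>i. y i + a * z i) ` (words a n \<times> words b n) \<subseteq> words (a * b) n"
  proof clarsimp
    fix y z assume yz: "y \<in> words a n" "z \<in> words b n"
    have "y i + a * z i < a * b" if "y i < a" "z i < b" for i
    proof -
      have "y i + a * z i < a * (z i + 1)" using that by simp
      also have "\<dots> \<le> a * b" using that by (intro mult_le_mono) auto
      finally show ?thesis .
    qed
    with yz show "(\<lambda>i. y i + a * z i) \<in> words (a * b) n"
      unfolding mem_words_iff by auto
  qed
  show "(\<lambda>x. (\<lambda>i. x i mod a, \<lambda>i. x i div a)) ` words (a * b) n \<subseteq> words a n \<times> words b n"
    using assms by (auto simp: mem_words_iff less_mult_imp_div_less mult.commute)
  show "\<forall>p\<in>words a n \<times> words b n. (\<lambda>x. (\<lambda>i. x i mod a, \<lambda>i. x i div a)) ((\<lambda>(y, z) i. y i + a * z i) p) = p"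
  proof
    fix p assume "p \<in> words a n \<times> words b n"
    then obtain y z where p: "p = (y, z)" "y \<in> words a n" by auto
    \<comment> \<open>Equality of functions is needed at every index; outside \<open>{1..n}\<close>
      the default 0 is below \<open>a\<close> because \<open>a > 0\<close>.\<close>
    have "y i < a" for i
      using p(2) assms by (cases "i \<in> {1..n}") (auto simp: mem_words_iff)
    then show "(\<lambda>x. (\<lambda>i. x i mod a, \<lambda>i. x i div a)) ((\<lambda>(y, z) i. y i + a * z i) p) = p"
      using assms by (simp add: p(1))
  qed
qed simp

text \<open>The low digits are added first, in base \<open>a\<close>; their carry \<open>k\<close>
  then enters the addition of the high digits in base \<open>b\<close>. Summing over
  \<open>k\<close> is Chapman-Kolmogorov without the normalisation.\<close>

lemma carry_count_mult:
  assumes "a > 0" "n > 0"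
  shows "carry_count (a * b) n 0 j = (\<Sum>k<n. carry_count a n 0 k * carry_count b n k j)"
proof -
  let ?S = "\<lambda>x. \<Sum>k=1..n. x k :: nat"
  let ?f = "\<lambda>x :: nat \<Rightarrow> nat. (\<lambda>i. x i mod a, \<lambda>i. x i div a)"
  let ?A = "{x \<in> words (a * b) n. ?S x div (a * b) = j}"
  let ?Y = "\<lambda>k. {y \<in> words a n. ?S y div a = k}"
  let ?Z = "\<lambda>k. {z \<in> words b n. (k + ?S z) div b = j}"
  let ?B = "\<Union>k<n. ?Y k \<times> ?Z k"
  have sum_eq: "?S x div (a * b) = (?S (\<lambda>i. x i mod a) div a + ?S (\<lambda>i. x i div a)) div b" for x
  proof -
    have "?S x = (\<Sum>k=1..n. x k mod a + a * (x k div a))" by simp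
    also have "\<dots> = ?S (\<lambda>i. x i mod a) + a * ?S (\<lambda>i. x i div a)"
      by (simp only: sum.distrib sum_distrib_left)
    finally show ?thesis using assms by (simp add: div_mult2_eq add.commute)
  qed
  \<comment> \<open>A sum of \<open>n\<close> letters below \<open>a\<close> is below
    \<open>n * a\<close>, so the intermediate carry is one of the \<open>n\<close> states of the
    chain.\<close>
  have lt: "?S y div a < n" if "y \<in> words a n" for y
  proof -
    have "?S y < (\<Sum>k=1..n. a)"
      using that assms by (intro sum_strict_mono) (auto simp: mem_words_iff)
    then show ?thesis using assms by (simp add: less_mult_imp_div_less)
  qed
  have bij: "bij_betw ?f (words (a * b) n) (words a n \<times> words b n)"
    using bij_betw_words_mult assms by blast
  have "bij_betw ?f ?A {p \<in> words a n \<times> words b n. (?S (fst p) div a + ?S (snd p)) div b = j}"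
    by (rule bij_betw_Collect[OF bij]) (simp only: sum_eq fst_conv snd_conv)
  also have "{p \<in> words a n \<times> words b n. (?S (fst p) div a + ?S (snd p)) div b = j} = ?B"
    using lt by auto
  finally have "card ?A = card ?B" by (rule bij_betw_same_card)
  also have "\<dots> = (\<Sum>k<n. card (?Y k \<times> ?Z k))"
    by (rule card_UN_disjoint) auto
  finally show ?thesis
    unfolding carry_count_def by (simp add: card_cartesian_product)
qed

text \<open>Base 1 is \<open>b ^ 0\<close>: only the zero word exists, and the count is row 0 of the
  identity matrix.\<close>

lemma carry_count_base_1: "carry_count 1 n 0 j = (if j = 0 then 1 else 0)"
proof -
  have "x i = 0" if "x \<in> words 1 n" for x i
    using that by (cases "i \<in> {1..n}") (auto simp: mem_words_iff)
  then have "words 1 n = {\<lambda>_. 0}" by (auto simp: fun_eq_iff) (auto simp: mem_words_iff)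
  then have "{x \<in> words 1 n. (0 + (\<Sum>k=1..n. x k)) div 1 = j} = (if j = 0 then {\<lambda>_. 0} else {})"
    by auto
  then show ?thesis unfolding carry_count_def by simp
qed

text \<open>One more matrix factor multiplies the base by \<open>b\<close>, and
  \<open>carry_count_mult\<close> is then the product of row 0 with the matrix.\<close>

lemma carries_mat_pow:
  assumes "b \<ge> 2" "j < n"
  shows "(carries_mat b n ^\<^sub>m r) $$ (0, j) = real (carry_count (b ^ r) n 0 j) / real (b ^ r) ^ n"
  using assms(2)
proof (induction r arbitrary: j)
  case 0
  then show ?case using carry_count_base_1[of n j] by (simp add: carries_mat_def)
next
  case (Suc r)
  let ?M = "carries_mat b n"
  have dims: "?M \<in> carrier_mat n n" "?M ^\<^sub>m r \<in> carrier_mat n n"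
    by (auto simp: carries_mat_def)
  have "(?M ^\<^sub>m Suc r) $$ (0, j) = (\<Sum>k<n. (?M ^\<^sub>m r) $$ (0, k) * ?M $$ (k, j))"
    using dims Suc.prems by (simp add: scalar_prod_def lessThan_atLeast0)
  also have "\<dots> = (\<Sum>k<n. real (carry_count (b ^ r) n 0 k) / real (b ^ r) ^ n
                       * (real (carry_count b n k j) / real b ^ n))"
    using Suc assms(1) by (intro sum.cong) (auto simp: carries_mat_def carries_prob_eq)
  also have "\<dots> = real (\<Sum>k<n. carry_count (b ^ r) n 0 k * carry_count b n k j)
                    / (real (b ^ r) ^ n * real b ^ n)"
    by (simp add: sum_divide_distrib)
  also have "(\<Sum>k<n. carry_count (b ^ r) n 0 k * carry_count b n k j) = carry_count (b ^ Suc r) n 0 j"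
    using carry_count_mult[of "b ^ r" n b j] assms(1) Suc.prems by (simp add: mult.commute)
  finally show ?case by (simp add: power_mult_distrib mult.commute)
qed

section \<open>Carries as descents of partial sums\<close>

definition word_sums :: "nat \<Rightarrow> nat \<Rightarrow> (nat \<Rightarrow> nat) \<Rightarrow> nat \<Rightarrow> nat" where
  "word_sums a n x i = (if i \<in> {1..n} then (\<Sum>k=1..i. x k) mod a else 0)"

text \<open>Consecutive partial sums differ by a letter modulo \<open>a\<close>, and letters are
  below \<open>a\<close>, so the word can be read back. An injective self-map of a finite set is
  onto.\<close>

lemma bij_betw_word_sums:
  assumes "a > 0"
  shows "bij_betw (word_sums a n) (words a n) (words a n)"
proof -
  have "inj_on (word_sums a n) (words a n)"
  proof (rule inj_onI)
    fix x y assume x: "x \<in> words a n" and y: "y \<in> words a n"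
      and eq: "word_sums a n x = word_sums a n y"
    \<comment> \<open>Index 0, the empty sum, is included so that the first letter is also a
      difference of two sums.\<close>
    have sums: "(\<Sum>k=1..i. x k) mod a = (\<Sum>k=1..i. y k) mod a" if "i \<le> n" for i
      using fun_cong[OF eq, of i] that by (cases "i = 0") (auto simp: word_sums_def)
    have "x (Suc i) = y (Suc i)" if i: "i < n" for i
    proof -
      have "[(\<Sum>k=1..i. x k) + x (Suc i) = (\<Sum>k=1..i. y k) + y (Suc i)] (mod a)"
        using sums[of "Suc i"] i by (simp add: unique_euclidean_semiring_class.cong_def)
      moreover have "[(\<Sum>k=1..i. x k) = (\<Sum>k=1..i. y k)] (mod a)"
        using sums[of i] i by (simp add: unique_euclidean_semiring_class.cong_def)
      ultimately have "[x (Suc i) = y (Suc i)] (mod a)"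
        by (meson cong_add cong_add_lcancel_nat cong_refl cong_sym cong_trans)
      moreover have "x (Suc i) < a" "y (Suc i) < a"
        using x y i by (auto simp: mem_words_iff)
      ultimately show ?thesis by (simp add: unique_euclidean_semiring_class.cong_def)
    qed
    then show "x = y"
      using x y unfolding mem_words_iff fun_eq_iff
      by (metis Suc_le_lessD Suc_pred atLeastAtMost_iff less_eq_Suc_le One_nat_def)
  qed
  moreover have "word_sums a n ` words a n \<subseteq> words a n"
    using assms by (auto simp: mem_words_iff word_sums_def)
  ultimately show ?thesis
    by (simp add: bij_betw_def endo_inj_surj)
qed

text \<open>Adding a digit produces a carry exactly when the running sum modulo \<open>a\<close> goes down.\<close>

lemma card_descents_word_sums:
  assumes "x \<in> words a n"
  shows "card (descents n (word_sums a n x)) = (\<Sum>k=1..n. x k) div a"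
proof -
  let ?S = "\<lambda>m. \<Sum>k=1..m. x k"
  have "card {i \<in> {1..m - 1}. ?S (i + 1) mod a < ?S i mod a} = ?S m div a" if "m \<le> n" for m
    using that
  proof (induction m)
    case 0
    then show ?case by simp
  next
    case (Suc m)
    let ?D = "\<lambda>m. {i \<in> {1..m - 1}. ?S (i + 1) mod a < ?S i mod a}"
    have xa: "x (Suc m) < a" using Suc.prems assms by (auto simp: mem_words_iff)
    show ?case
    proof (cases "m = 0")
      case True
      then show ?thesis using xa by simp
    next
      case False
      have *: "?S (Suc m) = ?S m + x (Suc m)" by simp
      let ?q = "?S m div a" and ?t = "?S m mod a"
      have dm: "?S m = a * ?q + ?t" by simp
      have ta: "?t < a" using xa by simp
      have step: "?S (Suc m) div a = ?q + (if ?S (Suc m) mod a < ?t then 1 else 0)"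
      proof (cases "?t + x (Suc m) < a")
        case True
        have "?S (Suc m) = a * ?q + (?t + x (Suc m))" using * dm by linarith
        then have "?S (Suc m) div a = ?q" "?S (Suc m) mod a = ?t + x (Suc m)"
          using True by (simp_all only: div_mult_self4 mod_mult_self4 div_less mod_less)
        then show ?thesis by simp
      next
        case False
        \<comment> \<open>The residue after a carry; \<open>x (Suc m) < a\<close> makes it strictly
          smaller than \<open>?t\<close>, which is the descent at \<open>m\<close>.\<close>
        define u where "u = ?t + x (Suc m) - a"
        have u: "u < ?t" "u < a" using False xa ta unfolding u_def by linarith+
        have "?S (Suc m) = a * (?q + 1) + u"
          using * dm False by (simp add: u_def)
        then have "?S (Suc m) div a = ?q + 1" "?S (Suc m) mod a = u"
          using u by (simp_all only: div_mult_self4 mod_mult_self4 div_less mod_less)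
        then show ?thesis using u by simp
      qed
      have "{1..Suc m - 1} = insert m {1..m - 1}" using False by auto
      then have "?D (Suc m) = ?D m \<union> (if ?S (Suc m) mod a < ?t then {m} else {})" by auto
      moreover have "m \<notin> ?D m" using False by auto
      ultimately have "card (?D (Suc m)) = card (?D m) + (if ?S (Suc m) mod a < ?t then 1 else 0)"
        by (auto simp: card_insert_if)
      then show ?thesis using Suc step by simp
    qed
  qed
  moreover have "descents n (word_sums a n x) = {i \<in> {1..n - 1}. ?S (i + 1) mod a < ?S i mod a}"
    by (auto simp: descents_def word_sums_def)
  ultimately show ?thesis by simp
qed

lemma carry_count_eq_descents:
  assumes "a > 0"
  shows "carry_count a n 0 j = card {s \<in> words a n. card (descents n s) = j}"
  unfolding carry_count_def add_0
  by (rule bij_betw_same_card[OF bij_betw_Collect[OF bij_betw_word_sums[OF assms]]])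
     (simp add: card_descents_word_sums)

section \<open>Words with distinct letters\<close>

text \<open>Inverse of standardisation: the elements of \<open>T\<close> arranged in the relative
  order of \<open>\<sigma>\<close>. The shift by 1 is there because \<open>enumerate\<close> counts
  from 0.\<close>

definition fill :: "nat \<Rightarrow> nat set \<Rightarrow> (nat \<Rightarrow> nat) \<Rightarrow> nat \<Rightarrow> nat" where
  "fill n T \<sigma> i = (if i \<in> {1..n} then enumerate T (\<sigma> i - 1) else 0)"

lemma bij_betw_enumerate_pred:
  fixes T :: "nat set"
  assumes "finite T"
  shows "bij_betw (\<lambda>i. enumerate T (i - 1)) {1..card T} T"
proof -
  have "bij_betw (\<lambda>i. i - 1) {1..card T} {..<card T}"
    by (rule bij_betw_byWitness[where f' = Suc]) auto
  from bij_betw_trans[OF this finite_bij_enumerate[OF assms]] show ?thesis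
    by (simp add: o_def)
qed

text \<open>On indices below \<open>card T\<close>, \<open>enumerate T\<close> is strictly
  increasing and so preserves comparisons.\<close>

lemma descents_fill:
  assumes "finite T" "card T = n" "\<sigma> permutes {1..n}"
  shows "descents n (fill n T \<sigma>) = descents n \<sigma>"
proof -
  have "fill n T \<sigma> (i + 1) < fill n T \<sigma> i \<longleftrightarrow> \<sigma> (i + 1) < \<sigma> i" if "i \<in> {1..n - 1}" for i
  proof -
    have i: "i \<in> {1..n}" "i + 1 \<in> {1..n}" using that by auto
    then have "\<sigma> i \<in> {1..n}" "\<sigma> (i + 1) \<in> {1..n}"
      using permutes_in_image[OF assms(3)] by blast+
    then show ?thesis using i assms(1,2)
      by (auto simp: fill_def)
  qed
  then show ?thesis by (auto simp: descents_def)
qed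

text \<open>A word with distinct letters is determined by its set of letters and the rank of the
  letter at each position.\<close>

lemma bij_betw_fill:
  "bij_betw (\<lambda>(T, \<sigma>). fill n T \<sigma>)
     ({T. T \<subseteq> {..<a} \<and> card T = n} \<times> {\<sigma>. \<sigma> permutes {1..n}})
     {s \<in> words a n. inj_on s {1..n}}"
proof (rule bij_betwI')
  have image: "fill n T \<sigma> ` {1..n} = T" and inj: "inj_on (fill n T \<sigma>) {1..n}"
    if "finite T" "card T = n" "\<sigma> permutes {1..n}" for T \<sigma>
  proof -
    have "bij_betw ((\<lambda>i. enumerate T (i - 1)) \<circ> \<sigma>) {1..n} T"
      using bij_betw_enumerate_pred[OF that(1)] permutes_imp_bij[OF that(3)] that(2)
      by (auto intro: bij_betw_trans)
    then have "bij_betw (fill n T \<sigma>) {1..n} T"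
      by (rule bij_betw_cong[THEN iffD1, rotated]) (simp add: fill_def)
    then show "fill n T \<sigma> ` {1..n} = T" "inj_on (fill n T \<sigma>) {1..n}"
      by (auto simp: bij_betw_def)
  qed
  note fin = finite_subset[OF _ finite_lessThan]
  {
    fix p q :: "nat set \<times> (nat \<Rightarrow> nat)"
    assume p: "p \<in> {T. T \<subseteq> {..<a} \<and> card T = n} \<times> {\<sigma>. \<sigma> permutes {1..n}}"
      and q: "q \<in> {T. T \<subseteq> {..<a} \<and> card T = n} \<times> {\<sigma>. \<sigma> permutes {1..n}}"
    obtain T \<sigma> U \<tau> where pq: "p = (T, \<sigma>)" "q = (U, \<tau>)" by (cases p, cases q)
    show "((case p of (T, \<sigma>) \<Rightarrow> fill n T \<sigma>) = (case q of (T, \<sigma>) \<Rightarrow> fill n T \<sigma>)) = (p = q)"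
    proof
      assume "(case p of (T, \<sigma>) \<Rightarrow> fill n T \<sigma>) = (case q of (T, \<sigma>) \<Rightarrow> fill n T \<sigma>)"
      then have eq: "fill n T \<sigma> = fill n U \<tau>" by (simp add: pq)
      have T: "finite T" "card T = n" "finite U" "card U = n" "\<sigma> permutes {1..n}" "\<tau> permutes {1..n}"
        using p q fin by (auto simp: pq)
      have TU: "T = U" using image[of T \<sigma>] image[of U \<tau>] T eq by metis
      have "\<sigma> i = \<tau> i" for i
      proof (cases "i \<in> {1..n}")
        case True
        then have "\<sigma> i \<in> {1..n}" "\<tau> i \<in> {1..n}"
          using permutes_in_image[OF T(5)] permutes_in_image[OF T(6)] by blast+
        moreover have "enumerate T (\<sigma> i - 1) = enumerate T (\<tau> i - 1)"
          using fun_cong[OF eq, of i] True TU by (simp add: fill_def)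
        ultimately show ?thesis
          using bij_betw_enumerate_pred[OF T(1)] T(2)
          by (auto simp: bij_betw_def dest: inj_onD)
      next
        case False
        then show ?thesis using permutes_not_in[OF T(5)] permutes_not_in[OF T(6)] by simp
      qed
      then show "p = q" by (simp add: pq TU fun_eq_iff)
    qed simp
  next
    fix p :: "nat set \<times> (nat \<Rightarrow> nat)"
    assume p: "p \<in> {T. T \<subseteq> {..<a} \<and> card T = n} \<times> {\<sigma>. \<sigma> permutes {1..n}}"
    obtain T \<sigma> where [simp]: "p = (T, \<sigma>)" by (cases p)
    have T: "finite T" "card T = n" "\<sigma> permutes {1..n}" "T \<subseteq> {..<a}"
      using p fin by auto
    have "fill n T \<sigma> i < a" if "i \<in> {1..n}" for i
      using image[OF T(1-3)] T(4) that by blast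
    then show "(case p of (T, \<sigma>) \<Rightarrow> fill n T \<sigma>) \<in> {s \<in> words a n. inj_on s {1..n}}"
      using inj[OF T(1-3)] by (auto simp: mem_words_iff) (auto simp: fill_def)
  next
    fix s assume s: "s \<in> {s \<in> words a n. inj_on s {1..n}}"
    define T where "T = s ` {1..n}"
    have T: "finite T" "card T = n" "T \<subseteq> {..<a}"
      using s by (auto simp: T_def card_image mem_words_iff)
    define e where "e = (\<lambda>i. enumerate T (i - 1))"
    have e: "bij_betw e {1..n} T"
      using bij_betw_enumerate_pred[OF T(1)] T(2) by (simp add: e_def)
    \<comment> \<open>The rank in \<open>T\<close> of the letter at position \<open>i\<close>,
      extended by the identity as \<open>permutes\<close> demands.\<close>
    define \<sigma> where "\<sigma> i = (if i \<in> {1..n} then inv_into {1..n} e (s i) else i)" for i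
    have "bij_betw (inv_into {1..n} e \<circ> s) {1..n} {1..n}"
      using s by (intro bij_betw_trans[OF _ bij_betw_inv_into[OF e]]) (auto simp: bij_betw_def T_def)
    then have "bij_betw \<sigma> {1..n} {1..n}"
      by (rule bij_betw_cong[THEN iffD1, rotated]) (simp add: \<sigma>_def)
    then have \<sigma>: "\<sigma> permutes {1..n}"
      by (rule bij_imp_permutes) (auto simp: \<sigma>_def)
    have "e (inv_into {1..n} e (s i)) = s i" if "i \<in> {1..n}" for i
      using e that by (intro f_inv_into_f) (auto simp: bij_betw_def T_def)
    then have "s = fill n T \<sigma>"
      using s by (auto simp: fun_eq_iff fill_def \<sigma>_def mem_words_iff e_def)
    then show "\<exists>p\<in>{T. T \<subseteq> {..<a} \<and> card T = n} \<times> {\<sigma>. \<sigma> permutes {1..n}}.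
        s = (case p of (T, \<sigma>) \<Rightarrow> fill n T \<sigma>)"
      using T \<sigma> by (intro bexI[of _ "(T, \<sigma>)"]) auto
  }
qed

text \<open>By \<open>descents_fill\<close> the descents depend on the permutation alone, so the
  letter set is free and contributes the binomial factor.\<close>

lemma card_inj_words_descents:
  "card {s \<in> words a n. inj_on s {1..n} \<and> card (descents n s) = j} = (a choose n) * num_perms_descents n j"
proof -
  let ?P = "{T. T \<subseteq> {..<a} \<and> card T = n} \<times> {\<sigma>. \<sigma> permutes {1..n}}"
  have "bij_betw (\<lambda>(T, \<sigma>). fill n T \<sigma>) {p \<in> ?P. card (descents n (snd p)) = j}
          {s \<in> {s \<in> words a n. inj_on s {1..n}}. card (descents n s) = j}"
    by (rule bij_betw_Collect[OF bij_betw_fill])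
       (auto simp: descents_fill finite_subset[OF _ finite_lessThan])
  moreover have "{p \<in> ?P. card (descents n (snd p)) = j}
      = {T. T \<subseteq> {..<a} \<and> card T = n} \<times> {\<sigma>. \<sigma> permutes {1..n} \<and> card (descents n \<sigma>) = j}"
    by auto
  moreover have "{s \<in> {s \<in> words a n. inj_on s {1..n}}. card (descents n s) = j}
      = {s \<in> words a n. inj_on s {1..n} \<and> card (descents n s) = j}"
    by auto
  ultimately have "card {s \<in> words a n. inj_on s {1..n} \<and> card (descents n s) = j}
      = card {T. T \<subseteq> {..<a} \<and> card T = n} * num_perms_descents n j"
    unfolding num_perms_descents_def card_cartesian_product[symmetric]
    by (metis (lifting) bij_betw_same_card)
  then show ?thesis using n_subsets[of "{..<a}" n] by simp
qed

section \<open>Lower bound for the counts, its equality case, and positivity of Eulerian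
  numbers\<close>

text \<open>Words with a repeated letter can only enlarge the count.\<close>

lemma carry_count_ge:
  assumes "a > 0"
  shows "carry_count a n 0 j \<ge> (a choose n) * num_perms_descents n j"
  unfolding carry_count_eq_descents[OF assms] card_inj_words_descents[symmetric]
  by (rule card_mono) auto

text \<open>A word with \<open>n - 1\<close> descents is strictly decreasing, hence has distinct letters.\<close>

lemma carry_count_last:
  assumes "a > 0"
  shows "carry_count a n 0 (n - 1) = (a choose n) * num_perms_descents n (n - 1)"
proof -
  have "inj_on s {1..n}" if "card (descents n s) = n - 1" for s
  proof -
    have eq: "descents n s = {1..n - 1}"
      by (rule card_subset_eq) (use that in \<open>auto simp: descents_def\<close>)
    have dec: "s (Suc i) < s i" if "1 \<le> i" "i < n" for i
    proof -
      have "i \<in> descents n s" unfolding eq using that by auto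
      then show ?thesis by (simp add: descents_def)
    qed
    have "s k < s i" if "1 \<le> i" "i < k" "k \<le> n" for i k
      using that
    proof (induction k)
      case 0
      then show ?case by simp
    next
      case (Suc k)
      then show ?case using dec[of k] by (cases "i = k") auto
    qed
    then show ?thesis
      unfolding inj_on_def by (metis atLeastAtMost_iff less_irrefl linorder_neqE_nat)
  qed
  then show ?thesis
    unfolding carry_count_eq_descents[OF assms] card_inj_words_descents[symmetric]
    by (intro arg_cong[of _ _ card]) auto
qed

text \<open>Ensures that the denominator \<open>carries_stat n j\<close> in \<open>sep_term\<close>
  is nonzero.\<close>

lemma num_perms_descents_pos:
  assumes "j < n"
  shows "num_perms_descents n j > 0"
proof -
  \<comment> \<open>Reverses the first \<open>j + 1\<close> positions and fixes the rest; it is its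
    own inverse.\<close>
  define \<sigma> where "\<sigma> i = (if i \<in> {1..j + 1} then j + 2 - i else i)" for i
  have "bij_betw \<sigma> {1..n} {1..n}"
    by (rule bij_betw_byWitness[where f' = \<sigma>]) (use assms in \<open>auto simp: \<sigma>_def\<close>)
  then have "\<sigma> permutes {1..n}"
    by (rule bij_imp_permutes) (use assms in \<open>auto simp: \<sigma>_def\<close>)
  moreover have "descents n \<sigma> = {1..j}"
    using assms by (auto simp: descents_def \<sigma>_def split: if_splits)
  ultimately have "{\<sigma>. \<sigma> permutes {1..n} \<and> card (descents n \<sigma>) = j} \<noteq> {}" by auto
  moreover have "finite {\<sigma>. \<sigma> permutes {1..n} \<and> card (descents n \<sigma>) = j}"
    by (rule finite_subset[OF _ finite_permutations[of "{1..n}"]]) auto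
  ultimately show ?thesis by (simp add: num_perms_descents_def card_gt_0_iff)
qed

section \<open>Separation distance as a birthday probability\<close>

text \<open>Both sides are the falling factorial of \<open>a\<close> over \<open>a ^ n\<close>, the
  chance that \<open>n\<close> uniform letters are distinct. For \<open>a < n\<close> the factor at
  \<open>i = a\<close> vanishes, as does the binomial coefficient.\<close>

lemma fact_mult_binomial_div_power:
  assumes "a > 0"
  shows "fact n * real (a choose n) / real a ^ n = (\<Prod>i<n. 1 - real i / real a)"
proof -
  have "fact n * real (a choose n) = (\<Prod>i<n. real a - real i)"
    by (simp add: binomial_gbinomial gbinomial_mult_fact lessThan_atLeast0)
  also have "\<dots> / real a ^ n = (\<Prod>i<n. (real a - real i) / real a)"
    by (simp add: prod_dividef)
  finally show ?thesis using assms by (simp add: diff_divide_distrib)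
qed

text \<open>The Eulerian number cancels between the bound of \<open>carry_count_ge\<close> and
  \<open>carries_stat\<close>, leaving a bound independent of \<open>j\<close>.\<close>

lemma sep_term_le:
  assumes "b \<ge> 2" "j < n"
  shows "sep_term b n r j \<le> 1 - (\<Prod>i<n. 1 - real i / real (b ^ r))"
proof -
  let ?a = "b ^ r"
  have a: "?a > 0" using assms by simp
  have pos: "num_perms_descents n j > 0" using assms(2) by (rule num_perms_descents_pos)
  have "(\<Prod>i<n. 1 - real i / real ?a)
      = real ((?a choose n) * num_perms_descents n j) / real ?a ^ n / carries_stat n j"
    using pos by (simp add: fact_mult_binomial_div_power[OF a, symmetric] carries_stat_def mult.commute del: of_nat_power)
  also have "\<dots> \<le> real (carry_count ?a n 0 j) / real ?a ^ n / carries_stat n j"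
    using carry_count_ge[OF a, where n = n and j = j]
    by (intro divide_right_mono) (auto simp: carries_stat_def simp del: of_nat_mult of_nat_power)
  finally show ?thesis
    by (simp add: sep_term_def carries_mat_pow[OF assms])
qed

lemma sep_term_last:
  assumes "b \<ge> 2" "n > 0"
  shows "sep_term b n r (n - 1) = 1 - (\<Prod>i<n. 1 - real i / real (b ^ r))"
proof -
  let ?a = "b ^ r"
  have a: "?a > 0" using assms by simp
  have n: "n - 1 < n" using assms by simp
  have pos: "num_perms_descents n (n - 1) > 0" using n by (rule num_perms_descents_pos)
  have "(\<Prod>i<n. 1 - real i / real ?a)
      = real ((?a choose n) * num_perms_descents n (n - 1)) / real ?a ^ n / carries_stat n (n - 1)"
    using pos by (simp add: fact_mult_binomial_div_power[OF a, symmetric] carries_stat_def mult.commute del: of_nat_power)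
  then show ?thesis
    by (simp only: sep_term_def carries_mat_pow[OF assms(1) n] carry_count_last[OF a])
qed

lemma sep_eq:
  assumes "b \<ge> 2" "n > 0"
  shows "sep b n r = sep_term b n r (n - 1)"
  unfolding sep_def
proof (rule Max_eqI)
  fix y assume "y \<in> sep_term b n r ` {0..n - 1}"
  then obtain j where "y = sep_term b n r j" "j < n" using assms by force
  then show "y \<le> sep_term b n r (n - 1)"
    using sep_term_le[of b j n r] sep_term_last[of b n r] assms by simp
qed auto

section \<open>Asymptotics of the birthday product\<close>

text \<open>The logarithm of the product is minus the sum of the \<open>i / A\<close>, up to
  quadratic errors. That sum is \<open>(1 - 1/n) / (2 c')\<close>, and the errors vanish because
  every \<open>i / A\<close> is of order \<open>1/n\<close>.\<close>

lemma birthday_limit: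
  fixes n :: "nat \<Rightarrow> nat" and c' :: "nat \<Rightarrow> real"
  assumes c: "c > 0" and n: "filterlim n at_top sequentially" and c': "c' \<longlonglongrightarrow> c"
  shows "(\<lambda>k. \<Prod>i<n k. 1 - real i / (real (n k) ^ 2 * c' k)) \<longlonglongrightarrow> exp (- 1 / (2 * c))"
proof -
  define A where "A k = real (n k) ^ 2 * c' k" for k
  define S where "S k = (\<Sum>i<n k. real i / A k)" for k
  define L where "L k = (\<Sum>i<n k. ln (1 - real i / A k))" for k
  have inv: "(\<lambda>k. 1 / real (n k)) \<longlonglongrightarrow> 0"
    using filterlim_compose[OF filterlim_real_sequentially n]
    by (intro tendsto_divide_0[OF tendsto_const] filterlim_at_top_imp_at_infinity)
  \<comment> \<open>Once \<open>c' k > c / 2\<close>, each \<open>i / A k\<close> is at most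
    \<open>2 / (c n)\<close>; the threshold \<open>4 / c\<close> for \<open>n\<close> brings this
    down to \<open>1 / 2\<close>, where the lower bound for \<open>ln\<close> applies.\<close>
  have ev: "\<forall>\<^sub>F k in sequentially. c' k > c / 2 \<and> n k > 0 \<and> real (n k) \<ge> 4 / c"
    using order_tendstoD(1)[OF c', of "c / 2"] c
      eventually_gt_at_top[of 0, THEN filterlim_iff[THEN iffD1, OF n, rule_format]]
      filterlim_at_top[THEN iffD1, OF filterlim_compose[OF filterlim_real_sequentially n], rule_format, of "4 / c"]
    by (auto intro: eventually_conj)
  have "(\<lambda>k. (1 - 1 / real (n k)) / (2 * c' k)) \<longlonglongrightarrow> (1 - 0) / (2 * c)"
    using c by (intro tendsto_intros inv c') auto
  moreover have "\<forall>\<^sub>F k in sequentially. (1 - 1 / real (n k)) / (2 * c' k) = S k"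
    using ev
  proof eventually_elim
    case (elim k)
    have "(\<Sum>i<m. real i) = real m * (real m - 1) / 2" for m
      by (induction m) (auto simp: field_simps)
    then have Sk: "S k = real (n k) * (real (n k) - 1) / 2 / A k"
      unfolding S_def sum_divide_distrib[symmetric] by (simp only:)
    have "c' k \<noteq> 0" "real (n k) \<noteq> 0" using elim c by auto
    then show ?case unfolding Sk A_def by (simp add: field_simps power2_eq_square)
  qed
  ultimately have S: "S \<longlonglongrightarrow> 1 / (2 * c)"
    by (simp add: Lim_transform_eventually)
  have bounds: "\<forall>\<^sub>F k in sequentially. A k > 0 \<and> (\<forall>i<n k. real i / A k \<le> 1 / 2)
      \<and> (\<forall>i<n k. real i / A k \<le> 2 / c * (1 / real (n k)))"
    using ev
  proof eventually_elim
    case (elim k)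
    have A: "A k \<ge> real (n k) ^ 2 * (c / 2)" unfolding A_def using elim by (intro mult_left_mono) auto
    moreover have pos: "real (n k) ^ 2 * (c / 2) > 0" using elim c by simp
    ultimately have "A k > 0" by linarith
    moreover have *: "real i / A k \<le> 2 / c * (1 / real (n k))" if "i < n k" for i
    proof -
      have "real i / A k \<le> real (n k) / (real (n k) ^ 2 * (c / 2))"
        using that A pos by (intro frac_le) auto
      then show ?thesis using elim c by (simp add: power2_eq_square field_simps)
    qed
    moreover have "2 / c * (1 / real (n k)) \<le> 1 / 2"
      using elim c by (simp add: field_simps)
    ultimately show ?case by (meson order.trans)
  qed
  have "L \<longlonglongrightarrow> - (1 / (2 * c))"
  proof (rule tendsto_sandwich)
    \<comment> \<open>From \<open>ln (1 - x) \<ge> - x - 2 * x^2\<close> on \<open>[0, 1/2]\<close>,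
      with one factor of \<open>x^2\<close> replaced by the uniform bound \<open>2 / (c n)\<close>,
      so that the total error is a null sequence times \<open>S k\<close>.\<close>
    show "\<forall>\<^sub>F k in sequentially. - S k - 2 * (2 / c * (1 / real (n k))) * S k \<le> L k"
      using bounds
    proof eventually_elim
      case (elim k)
      let ?e = "2 / c * (1 / real (n k))"
      have "- S k - 2 * ?e * S k = (\<Sum>i<n k. - (real i / A k) - 2 * (?e * (real i / A k)))"
        by (simp add: S_def sum_subtractf sum_negf sum_distrib_left mult.assoc)
      also have "\<dots> \<le> L k"
        unfolding L_def
      proof (rule sum_mono)
        fix i assume "i \<in> {..<n k}"
        then have i: "0 \<le> real i / A k" "real i / A k \<le> 1 / 2" "real i / A k \<le> ?e"
          using elim by auto
        have "(real i / A k)\<^sup>2 \<le> ?e * (real i / A k)"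
          unfolding power2_eq_square using i by (intro mult_right_mono) auto
        then show "- (real i / A k) - 2 * (?e * (real i / A k)) \<le> ln (1 - real i / A k)"
          using ln_one_minus_pos_lower_bound[OF i(1,2)] by linarith
      qed
      finally show ?case .
    qed
    show "\<forall>\<^sub>F k in sequentially. L k \<le> - S k"
      using bounds
    proof eventually_elim
      case (elim k)
      have "L k \<le> (\<Sum>i<n k. - (real i / A k))"
        unfolding L_def using elim
        by (intro sum_mono ln_one_minus_pos_upper_bound) (auto intro: le_less_trans[of _ "1 / 2"])
      then show ?case by (simp add: S_def sum_negf)
    qed
    have "(\<lambda>k. - S k - 2 * (2 / c * (1 / real (n k))) * S k)
        \<longlonglongrightarrow> - (1 / (2 * c)) - 2 * (2 / c * 0) * (1 / (2 * c))"
      by (intro tendsto_intros S inv)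
    then show "(\<lambda>k. - S k - 2 * (2 / c * (1 / real (n k))) * S k) \<longlonglongrightarrow> - (1 / (2 * c))" by simp
    show "(\<lambda>k. - S k) \<longlonglongrightarrow> - (1 / (2 * c))" by (intro tendsto_intros S)
  qed
  then have "(\<lambda>k. exp (L k)) \<longlonglongrightarrow> exp (- 1 / (2 * c))"
    by (auto intro: tendsto_eq_intros)
  moreover have "\<forall>\<^sub>F k in sequentially. exp (L k) = (\<Prod>i<n k. 1 - real i / A k)"
    using bounds
  proof eventually_elim
    case (elim k)
    have "exp (ln (1 - real i / A k)) = 1 - real i / A k" if "i < n k" for i
    proof -
      have "real i / A k \<le> 1 / 2" using elim that by blast
      then show ?thesis by (intro exp_ln) linarith
    qed
    then show ?case by (simp add: L_def exp_sum)
  qed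
  ultimately have "(\<lambda>k. \<Prod>i<n k. 1 - real i / A k) \<longlonglongrightarrow> exp (- 1 / (2 * c))"
    by (rule Lim_transform_eventually)
  then show ?thesis unfolding A_def .
qed

theorem theorem4p3:
  fixes b :: nat
  assumes "b \<ge> 2"
  shows "(\<forall>n r :: nat. n \<ge> 2 \<longrightarrow> sep b n r = sep_term b n r (n - 1))
       \<and> (\<forall>(c :: real) (n :: nat \<Rightarrow> nat) (r :: nat \<Rightarrow> nat) (c' :: nat \<Rightarrow> real).
            c > 0 \<longrightarrow> filterlim n at_top sequentially \<longrightarrow> c' \<longlonglongrightarrow> c \<longrightarrow>
            (\<forall>k. real (r k) = 2 * log (real b) (real (n k)) + log (real b) (c' k)) \<longrightarrow>
            (\<lambda>k. sep b (n k) (r k)) \<longlonglongrightarrow> 1 - exp (- 1 / (2 * c)))"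
proof (intro conjI allI impI)
  fix n r :: nat
  assume "n \<ge> 2"
  then show "sep b n r = sep_term b n r (n - 1)" using assms by (intro sep_eq) auto
next
  fix c :: real and n r :: "nat \<Rightarrow> nat" and c' :: "nat \<Rightarrow> real"
  assume c: "c > 0" and n: "filterlim n at_top sequentially" and c': "c' \<longlonglongrightarrow> c"
    and r: "\<forall>k. real (r k) = 2 * log (real b) (real (n k)) + log (real b) (c' k)"
  have "(\<lambda>k. 1 - (\<Prod>i<n k. 1 - real i / (real (n k) ^ 2 * c' k))) \<longlonglongrightarrow> 1 - exp (- 1 / (2 * c))"
    by (intro tendsto_intros birthday_limit c n c')
  \<comment> \<open>Positivity, available only from some \<open>k\<close> on, is used to turn the
    equation between logarithms into one between their arguments.\<close>
  moreover have "\<forall>\<^sub>F k in sequentially. n k > 0 \<and> c' k > 0"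
    using eventually_gt_at_top[of 0, THEN filterlim_iff[THEN iffD1, OF n, rule_format]] order_tendstoD(1)[OF c' c]
    by (rule eventually_conj)
  then have "\<forall>\<^sub>F k in sequentially.
      1 - (\<Prod>i<n k. 1 - real i / (real (n k) ^ 2 * c' k)) = sep b (n k) (r k)"
  proof eventually_elim
    case (elim k)
    \<comment> \<open>Exponentiating identifies the base \<open>b ^ r k\<close> with
      \<open>n^2 c'\<close>, so the birthday product for that base is the one whose limit is
      known.\<close>
    have "real (r k) = log b (real (n k) ^ 2 * c' k)"
      using r elim assms by (simp add: log_mult log_nat_power)
    then have "real b powr real (r k) = real (n k) ^ 2 * c' k"
      using elim assms by simp
    then have "real (b ^ r k) = real (n k) ^ 2 * c' k"
      using assms by (simp add: powr_realpow)
    then show ?case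
      using elim assms by (simp only: sep_eq sep_term_last)
  qed
  ultimately show "(\<lambda>k. sep b (n k) (r k)) \<longlonglongrightarrow> 1 - exp (- 1 / (2 * c))"
    by (rule Lim_transform_eventually)
qed

end
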